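(* Let $T$ be a positive integer and let $y:\{0,1,\dots,T\}\to\mathbb{R}$ be a function with $y(0)\ge 0$. Then there exists a unique pair $(v,g)$ of real-valued functions on $\{0,1,\dots,T\}$ such that, for all $t\in\{0,1,\dots,T\}$: (i) $v(t)=y(t)+g(t)$; (ii) $v(t)\ge 0$; (iii) $g$ is increasing (non-decreasing), $g(0)=0$, and $$\sum_{1\le t\le T} v(t)\,(g(t)-g(t-1))=0.$$ Moreover, the function $g$ is given by $g(t)=\sup_{0\le s\le t}\big((-y(s))\vee 0\big)$.
   Context: $a\vee b$ denotes $\max(a,b)$. *)

theory Defs
  imports Complex_Main "HOL-Library.FuncSet"
begin

text \<open>
  Functions on \<open>{0,\<dots>,T}\<close> are extensional functions on \<open>nat\<close>: they take the value
  \<open>undefined\<close> outside \<open>{0..T}\<close>, so that equality of such functions is equality on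
  \<open>{0..T}\<close> and uniqueness has its usual meaning.
\<close>

definition reflection_pair :: "nat \<Rightarrow> (nat \<Rightarrow> real) \<Rightarrow> (nat \<Rightarrow> real) \<Rightarrow> (nat \<Rightarrow> real) \<Rightarrow> bool" where
  "reflection_pair T y v g \<longleftrightarrow>
     v \<in> {0..T} \<rightarrow>\<^sub>E UNIV \<and> g \<in> {0..T} \<rightarrow>\<^sub>E UNIV \<and>
     (\<forall>t\<in>{0..T}. v t = y t + g t) \<and>
     (\<forall>t\<in>{0..T}. v t \<ge> 0) \<and>
     mono_on {0..T} g \<and> g 0 = 0 \<and>
     (\<Sum>t=1..T. v t * (g t - g (t - 1))) = 0"

end

theory Submission
  imports Defs
begin

text \<open>
  All summands in the complementarity condition are nonnegative, so each of them vanishes: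
  \<open>g\<close> can only increase at a time \<open>t\<close> with \<open>v t = 0\<close>, and then it increases to \<open>- y t\<close>.
  This is equivalent to the recursion \<open>g (t + 1) = max (g t) (max (- y (t + 1)) 0)\<close>,
  which the running maximum of \<open>max (- y) 0\<close> satisfies.
\<close>

definition regulator :: "(nat \<Rightarrow> real) \<Rightarrow> nat \<Rightarrow> real" where
  "regulator y t = (SUP s\<in>{0..t}. max (- y s) 0)"

lemma regulator_0: "regulator y 0 = max (- y 0) 0"
  by (simp add: regulator_def)

lemma regulator_Suc: "regulator y (Suc t) = max (regulator y t) (max (- y (Suc t)) 0)"
proof -
  have "regulator y (Suc t) =
      Sup (insert (max (- y (Suc t)) 0) ((\<lambda>s. max (- y s) 0) ` {0..t}))"
    by (simp add: regulator_def atLeastAtMostSuc_conv)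
  \<comment> \<open>On the reals \<open>Sup\<close> is only conditionally complete:
    \<open>cSup_insert\<close> applies because the image of \<open>{0..t}\<close> is nonempty and,
    being finite, bounded above.\<close>
  also have "\<dots> = max (max (- y (Suc t)) 0) (regulator y t)"
    unfolding regulator_def by (subst cSup_insert) (auto simp: sup_max)
  finally show ?thesis
    by (simp add: max.commute)
qed

lemma mono_regulator: "mono (regulator y)"
  by (simp add: mono_iff_le_Suc regulator_Suc)

lemma regulator_upper: "max (- y t) 0 \<le> regulator y t"
  by (cases t) (simp_all add: regulator_0 regulator_Suc)

text \<open>The existence half. The hypothesis on \<open>y 0\<close> makes the running maximum start
  at 0.\<close>

lemma reflection_pair_regulator:
  assumes "y 0 \<ge> 0"
  shows "reflection_pair T y (restrict (\<lambda>t. y t + regulator y t) {0..T}) (restrict (regulator y) {0..T})"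
proof -
  have nonneg: "0 \<le> y t + regulator y t" for t
    using regulator_upper[of y t] by simp
  \<comment> \<open>If the regulator jumps, its new value exceeds \<open>regulator y t\<close>,
    which is at least 0, so the new value is \<open>- y (Suc t)\<close> and the first factor
    vanishes. Otherwise the second factor does.\<close>
  have "(y (Suc t) + regulator y (Suc t)) * (regulator y (Suc t) - regulator y t) = 0" for t
    using regulator_upper[of y t] by (auto simp: regulator_Suc max_def split: if_splits)
  then have compl: "(y t + regulator y t) * (regulator y t - regulator y (t - 1)) = 0" if "t \<ge> 1" for t
    using that by (cases t) simp_all
  have "mono_on {0..T} (restrict (regulator y) {0..T})"
    by (auto intro!: mono_onI monoD[OF mono_regulator])
  moreover have "regulator y 0 = 0"
    using assms by (simp add: regulator_0)
  ultimately show ?thesis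
    using nonneg compl by (auto simp: reflection_pair_def intro!: sum.neutral)
qed

text \<open>Complementarity leaves two cases. If \<open>v (Suc t) = 0\<close>, then
  \<open>g (Suc t) = - y (Suc t)\<close>, which by monotonicity is at least \<open>g t\<close> and
  hence at least 0. If \<open>g\<close> does not move, \<open>v (Suc t) \<ge> 0\<close> says that
  \<open>g t\<close> already dominates \<open>- y (Suc t)\<close>. The maximum is attained
  accordingly.\<close>

lemma reflection_pair_Suc:
  assumes pair: "reflection_pair T y v g" and t: "Suc t \<le> T"
  shows "g (Suc t) = max (g t) (max (- y (Suc t)) 0)"
proof -
  have v: "v s = y s + g s" "v s \<ge> 0" if "s \<le> T" for s
    using pair that by (auto simp: reflection_pair_def)
  have g: "g r \<le> g s" if "r \<le> s" "s \<le> T" for r s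
    using pair that by (auto simp: reflection_pair_def intro: mono_onD)
  have g0: "g 0 = 0" and sum0: "(\<Sum>s=1..T. v s * (g s - g (s - 1))) = 0"
    using pair by (auto simp: reflection_pair_def)
  have "v s * (g s - g (s - 1)) \<ge> 0" if "s \<in> {1..T}" for s
    using that v(2) g[of "s - 1" s] by simp
  with sum0 have "\<forall>s\<in>{1..T}. v s * (g s - g (s - 1)) = 0"
    by (subst (asm) sum_nonneg_eq_0_iff) auto
  from bspec[OF this, of "Suc t"] t have "v (Suc t) = 0 \<or> g (Suc t) = g t"
    by simp
  moreover have "g t \<le> g (Suc t)" "0 \<le> g t"
    using g[of t "Suc t"] g[of 0 t] g0 t by auto
  ultimately show ?thesis
    using v[OF t] by (auto simp: max_def)
qed

lemma reflection_pair_eq_regulator: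
  assumes pair: "reflection_pair T y v g" and "t \<le> T"
  shows "g t = regulator y t"
  using \<open>t \<le> T\<close>
proof (induction t)
  case 0
  \<comment> \<open>The sign of \<open>y 0\<close> is read off from the pair itself:
    \<open>y 0 = v 0 \<ge> 0\<close> because \<open>g 0 = 0\<close>.\<close>
  have "g 0 = 0" "\<forall>t\<in>{0..T}. v t = y t + g t" "\<forall>t\<in>{0..T}. v t \<ge> 0"
    using pair unfolding reflection_pair_def by blast+
  then have "g 0 = 0" "y 0 \<ge> 0"
    by (metis add_0_right atLeastAtMost_iff le0)+
  then show ?case
    by (simp add: regulator_0)
next
  case (Suc t)
  then show ?case
    using reflection_pair_Suc[OF pair Suc.prems] by (simp add: regulator_Suc)
qed

text \<open>The recursion determines the values on \<open>{0..T}\<close>; extensionality settles the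
  rest, giving equality of total functions.\<close>

lemma reflection_pair_unique:
  assumes "reflection_pair T y v g"
  shows "g = restrict (regulator y) {0..T}" and "v = restrict (\<lambda>t. y t + regulator y t) {0..T}"
proof -
  have "g \<in> extensional {0..T}" "v \<in> extensional {0..T}" "\<forall>t\<in>{0..T}. v t = y t + g t"
    using assms by (auto simp: reflection_pair_def PiE_def)
  then show "g = restrict (regulator y) {0..T}" "v = restrict (\<lambda>t. y t + regulator y t) {0..T}"
    using reflection_pair_eq_regulator[OF assms]
    by (auto intro!: extensionalityI[where A = "{0..T}"])
qed

theorem lemma2p6:
  fixes T :: nat and y :: "nat \<Rightarrow> real"
  assumes "T > 0" and "y 0 \<ge> 0"
  shows "(\<exists>!(v, g). reflection_pair T y v g) \<and>
    (\<forall>v g. reflection_pair T y v g \<longrightarrow>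
       (\<forall>t\<in>{0..T}. g t = (SUP s\<in>{0..t}. max (- y s) 0)))"
proof
  let ?v = "restrict (\<lambda>t. y t + regulator y t) {0..T}" and ?g = "restrict (regulator y) {0..T}"
  show "\<exists>!(v, g). reflection_pair T y v g"
  proof (rule ex1I[of _ "(?v, ?g)"])
    show "case (?v, ?g) of (v, g) \<Rightarrow> reflection_pair T y v g"
      unfolding prod.case using \<open>y 0 \<ge> 0\<close> by (rule reflection_pair_regulator)
    show "p = (?v, ?g)" if "case p of (v, g) \<Rightarrow> reflection_pair T y v g" for p
      using that reflection_pair_unique[of T y "fst p" "snd p"] by (simp add: case_prod_beta prod_eq_iff)
  qed
  show "\<forall>v g. reflection_pair T y v g \<longrightarrow>
      (\<forall>t\<in>{0..T}. g t = (SUP s\<in>{0..t}. max (- y s) 0))"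
    using reflection_pair_eq_regulator unfolding regulator_def by simp
qed

end
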